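(* $K_1(\mathrm{Maj})=2$. That is, the constant function $k(n)=2$ belongs to $K_1(\mathrm{Maj})$, while the constant function $k(n)=1$ does not.
   Context: $\mathcal{A}(n,k,p)$ is the set of all probability distributions $\mathbb{Q}$ of $n$ bits $(X_1,\ldots,X_n)\in\{0,1\}^n$ that are $k$-wise independent (every subset of at most $k$ of the bits is independent) and satisfy $\mathbb{Q}(X_i=1)=p$ for all $i$. $\mathbb{P}_p$ is the distribution of $n$ fully independent bits, each equal to $1$ with probability $p$. For $f:\{0,1\}^n\to\{0,1\}$, $\varepsilon^f(k,p)=\max_{\mathbb{Q}\in\mathcal{A}(n,k,p)}\mathbb{Q}(f=1)-\min_{\mathbb{Q}\in\mathcal{A}(n,k,p)}\mathbb{Q}(f=1)$. For a sequence $f=(f_n)$ of monotone boolean functions with a sharp threshold at $p_c$ (meaning $\lim_n\mathbb{P}_p(f_n=1)$ is $0$ for $p<p_c$ and $1$ for $p>p_c$), $K_1(f)$ is the class of functions $k(n)$ such that $\varepsilon^{f_n}(k(n),p)\to0$ as $n\to\infty$ for every $p\ne p_c$. $\mathrm{Maj}_n$ ($n$ odd) is the majority function on $n$ bits: its output is the bit occurring more often in the input; it has sharp threshold at $p_c=1/2$, and the sequence is indexed by odd $n$. *)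

theory Defs
  imports "HOL-Probability.Probability"
begin

text \<open>
  An element of \<open>{0,1}\<^sup>n\<close> is encoded as a function on \<^typ>\<open>nat\<close> that is \<^const>\<open>False\<close> outside
  \<open>{..<n}\<close>; this is the convention of \<^const>\<open>Pi_pmf\<close> with default value \<^const>\<open>False\<close>.
\<close>

definition cube :: "nat \<Rightarrow> (nat \<Rightarrow> bool) set" where
  "cube n = PiE_dflt {..<n} False (\<lambda>_. UNIV)"

definition kwise_independent :: "nat \<Rightarrow> nat \<Rightarrow> (nat \<Rightarrow> bool) pmf \<Rightarrow> bool" where
  "kwise_independent n k Q \<longleftrightarrow>
     (\<forall>S\<subseteq>{..<n}. card S \<le> k \<longrightarrow>
        prob_space.indep_vars (measure_pmf Q) (\<lambda>_. count_space UNIV) (\<lambda>i x. x i) S)"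

definition kwise_dists :: "nat \<Rightarrow> nat \<Rightarrow> real \<Rightarrow> (nat \<Rightarrow> bool) pmf set" where
  "kwise_dists n k p =
     {Q. set_pmf Q \<subseteq> cube n \<and> kwise_independent n k Q \<and>
         (\<forall>i<n. measure_pmf.prob Q {x. x i} = p)}"

definition indep_bits :: "nat \<Rightarrow> real \<Rightarrow> (nat \<Rightarrow> bool) pmf" where
  "indep_bits n p = Pi_pmf {..<n} False (\<lambda>_. bernoulli_pmf p)"

text \<open>
  For \<open>p \<in> {0..1}\<close> the supremum and the infimum are a maximum and a minimum; see
  \<open>kwise_dists_attains_max\<close> and \<open>kwise_dists_attains_min\<close> below.
\<close>

definition eps :: "nat \<Rightarrow> ((nat \<Rightarrow> bool) \<Rightarrow> bool) \<Rightarrow> nat \<Rightarrow> real \<Rightarrow> real" where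
  "eps n f k p =
     (SUP Q\<in>kwise_dists n k p. measure_pmf.prob Q {x. f x}) -
     (INF Q\<in>kwise_dists n k p. measure_pmf.prob Q {x. f x})"

text \<open>
  A sequence \<open>(f\<^sub>n)\<close> may be indexed by an infinite set \<open>N\<close> of naturals only; limits
  are then taken as \<open>n \<rightarrow> \<infinity>\<close> within \<open>N\<close>, and the values off \<open>N\<close> are irrelevant.
\<close>

definition at_top_within :: "nat set \<Rightarrow> nat filter" where
  "at_top_within N = inf sequentially (principal N)"

definition has_sharp_threshold ::
  "nat set \<Rightarrow> (nat \<Rightarrow> (nat \<Rightarrow> bool) \<Rightarrow> bool) \<Rightarrow> real \<Rightarrow> bool" where
  "has_sharp_threshold N f pc \<longleftrightarrow>
     pc \<in> {0..1} \<and>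
     (\<forall>n\<in>N. mono_on (cube n) (f n)) \<and>
     (\<forall>p\<in>{0..1}. p < pc \<longrightarrow>
        ((\<lambda>n. measure_pmf.prob (indep_bits n p) {x. f n x}) \<longlongrightarrow> 0) (at_top_within N)) \<and>
     (\<forall>p\<in>{0..1}. p > pc \<longrightarrow>
        ((\<lambda>n. measure_pmf.prob (indep_bits n p) {x. f n x}) \<longlongrightarrow> 1) (at_top_within N))"

text \<open>
  Unique whenever it exists and \<open>N\<close> is infinite: see \<open>has_sharp_threshold_unique\<close> below.
\<close>

definition critical_prob :: "nat set \<Rightarrow> (nat \<Rightarrow> (nat \<Rightarrow> bool) \<Rightarrow> bool) \<Rightarrow> real" where
  "critical_prob N f = (THE pc. has_sharp_threshold N f pc)"

definition K1 :: "nat set \<Rightarrow> (nat \<Rightarrow> (nat \<Rightarrow> bool) \<Rightarrow> bool) \<Rightarrow> (nat \<Rightarrow> nat) set" where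
  "K1 N f =
     {k. \<forall>p\<in>{0..1}. p \<noteq> critical_prob N f \<longrightarrow>
           ((\<lambda>n. eps n (f n) (k n) p) \<longlongrightarrow> 0) (at_top_within N)}"

definition Maj :: "nat \<Rightarrow> (nat \<Rightarrow> bool) \<Rightarrow> bool" where
  "Maj n x \<longleftrightarrow> card {i. i < n \<and> x i} > card {i. i < n \<and> \<not> x i}"

lemma has_sharp_threshold_unique:
  assumes N: "infinite N" and a: "has_sharp_threshold N f a" and b: "has_sharp_threshold N f b"
  shows "a = b"
proof -
  have nontriv: "at_top_within N \<noteq> bot"
  proof
    assume "at_top_within N = bot"
    then have "\<forall>\<^sub>F n in sequentially. n \<notin> N"
      by (simp add: at_top_within_def trivial_limit_def eventually_inf_principal)
    then show False
      using N by (auto simp: eventually_sequentially infinite_nat_iff_unbounded_le)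
  qed
  have False if ab: "c < d" and c: "has_sharp_threshold N f c" and d: "has_sharp_threshold N f d" for c d
  proof -
    define p where "p = (c + d) / 2"
    have p: "p \<in> {0..1}" "c < p" "p < d"
      using ab c d by (auto simp: p_def has_sharp_threshold_def)
    have "((\<lambda>n. measure_pmf.prob (indep_bits n p) {x. f n x}) \<longlongrightarrow> 1) (at_top_within N)"
      using c p by (auto simp: has_sharp_threshold_def)
    moreover have "((\<lambda>n. measure_pmf.prob (indep_bits n p) {x. f n x}) \<longlongrightarrow> 0) (at_top_within N)"
      using d p by (auto simp: has_sharp_threshold_def)
    ultimately show False
      using tendsto_unique[OF nontriv] by fastforce
  qed
  then show ?thesis
    using a b by (metis linorder_neqE)
qed

lemma finite_cube: "finite (cube n)"
  unfolding cube_def by (intro finite_PiE_dflt) auto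

lemma indep_bits_in_kwise_dists:
  assumes "p \<in> {0..1}"
  shows "indep_bits n p \<in> kwise_dists n k p"
proof -
  have "set_pmf (indep_bits n p) \<subseteq> cube n"
    unfolding indep_bits_def cube_def
    by (subst set_Pi_pmf) (auto simp: PiE_dflt_def)
  moreover have "kwise_independent n k (indep_bits n p)"
    unfolding kwise_independent_def indep_bits_def
    by (auto intro!: prob_space.indep_vars_subset[OF _ indep_vars_Pi_pmf]
          measure_pmf.prob_space_axioms)
  moreover have "measure_pmf.prob (indep_bits n p) {x. x i} = p" if "i < n" for i
  proof -
    have "measure_pmf.prob (indep_bits n p) {x. x i} =
            measure_pmf.prob (map_pmf (\<lambda>x. x i) (indep_bits n p)) {True}"
      by (simp add: vimage_def)
    also have "map_pmf (\<lambda>x. x i) (indep_bits n p) = bernoulli_pmf p"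
      unfolding indep_bits_def using that by (subst Pi_pmf_component) auto
    finally show ?thesis
      using assms by (simp add: measure_pmf_single)
  qed
  ultimately show ?thesis
    by (simp add: kwise_dists_def)
qed

lemma kwise_independent_iff:
  "kwise_independent n k Q \<longleftrightarrow>
     (\<forall>S\<subseteq>{..<n}. card S \<le> k \<longrightarrow> (\<forall>J\<subseteq>S. J \<noteq> {} \<longrightarrow> finite J \<longrightarrow>
        (\<forall>B. measure_pmf.prob Q {x. \<forall>j\<in>J. x j \<in> B j} =
              (\<Prod>j\<in>J. measure_pmf.prob Q {x. x j \<in> B j}))))"
proof -
  have "prob_space.indep_vars (measure_pmf Q) (\<lambda>_. count_space UNIV) (\<lambda>i x. x i) S \<longleftrightarrow>
     (\<forall>J\<subseteq>S. J \<noteq> {} \<longrightarrow> finite J \<longrightarrow>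
        (\<forall>B. measure_pmf.prob Q {x. \<forall>j\<in>J. x j \<in> B j} =
              (\<Prod>j\<in>J. measure_pmf.prob Q {x. x j \<in> B j})))" (is "?L \<longleftrightarrow> ?R") for S :: "nat set"
  proof
    assume L: ?L
    show ?R
    proof (intro allI impI)
      fix J and B :: "nat \<Rightarrow> bool set"
      assume J: "J \<subseteq> S" "J \<noteq> {}" "finite J"
      let ?A = "\<lambda>j. (\<lambda>x::nat \<Rightarrow> bool. x j) -` B j"
      have "measure_pmf.prob Q (\<Inter>j\<in>J. ?A j) = (\<Prod>j\<in>J. measure_pmf.prob Q (?A j))"
        using L J unfolding prob_space.indep_vars_def2[OF measure_pmf.prob_space_axioms] prob_space.indep_sets_def[OF measure_pmf.prob_space_axioms]
        by (auto simp: Pi_iff)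
      moreover have "(\<Inter>j\<in>J. ?A j) = {x. \<forall>j\<in>J. x j \<in> B j}" by auto
      ultimately show "measure_pmf.prob Q {x. \<forall>j\<in>J. x j \<in> B j} =
              (\<Prod>j\<in>J. measure_pmf.prob Q {x. x j \<in> B j})"
        by (simp add: vimage_def)
    qed
  next
    assume R: ?R
    show ?L
      unfolding prob_space.indep_vars_def2[OF measure_pmf.prob_space_axioms] prob_space.indep_sets_def[OF measure_pmf.prob_space_axioms]
    proof (intro conjI ballI allI impI)
      fix J A
      assume J: "J \<subseteq> S" "J \<noteq> {}" "finite J"
        and A: "A \<in> (\<Pi> i\<in>J. {(\<lambda>x. x i) -` A \<inter> space (measure_pmf Q) |A. A \<in> sets (count_space UNIV)})"
      have "\<forall>j\<in>J. \<exists>b. A j = {x. x j \<in> b}"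
        using A by (auto simp: Pi_iff vimage_def)
      then obtain B where B: "\<And>j. j \<in> J \<Longrightarrow> A j = {x. x j \<in> B j}"
        by metis
      have "(\<Inter>j\<in>J. A j) = {x. \<forall>j\<in>J. x j \<in> B j}"
        using B by auto
      then show "measure_pmf.prob Q (\<Inter>j\<in>J. A j) = (\<Prod>j\<in>J. measure_pmf.prob Q (A j))"
        using R J B by simp
    qed auto
  qed
  then show ?thesis
    unfolding kwise_independent_def by simp
qed

lemma kwise_dists_attains:
  assumes p: "p \<in> {0..1}"
  shows "\<exists>Q\<in>kwise_dists n k p. \<forall>Q'\<in>kwise_dists n k p.
           measure_pmf.prob Q' F \<le> measure_pmf.prob Q F"
proof -
  define C where "C = cube n"
  have C: "finite C" by (simp add: C_def finite_cube)
  define m :: "((nat \<Rightarrow> bool) \<Rightarrow> real) \<Rightarrow> (nat \<Rightarrow> bool) set \<Rightarrow> real"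
    where "m = (\<lambda>v E. \<Sum>x\<in>E \<inter> C. v x)"
  have cont: "continuous_on UNIV (\<lambda>v. m v E)" for E
    unfolding m_def by (intro continuous_intros continuous_on_product_coordinates)
  define V where "V = (PiE UNIV (\<lambda>x. if x \<in> C then {0..1} else {0::real})) \<inter>
    ({v. m v UNIV = 1} \<inter> {v. \<forall>i. i < n \<longrightarrow> m v {x. x i} = p} \<inter>
     {v. \<forall>S. S\<subseteq>{..<n} \<longrightarrow> card S \<le> k \<longrightarrow> (\<forall>J. J\<subseteq>S \<longrightarrow> J \<noteq> {} \<longrightarrow> finite J \<longrightarrow>
        (\<forall>B. m v {x. \<forall>j\<in>J. x j \<in> B j} = (\<Prod>j\<in>J. m v {x. x j \<in> B j})))})"
  have "compact (PiE UNIV (\<lambda>x. if x \<in> C then {0..1} else {0::real}))"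
    by (subst compactin_euclidean_iff[symmetric], subst euclidean_product_topology[symmetric],
        subst compactin_PiE) auto
  then have "compact V"
    unfolding V_def
    by (intro compact_Int_closed closed_Int closed_Collect_all closed_Collect_imp
          closed_Collect_eq cont continuous_intros) auto
  have m_eq: "m (pmf Q) E = measure_pmf.prob Q E" if "set_pmf Q \<subseteq> C" for Q E
  proof -
    have "measure_pmf.prob Q E = measure_pmf.prob Q (E \<inter> C)"
      by (rule measure_prob_cong_0) (use that in \<open>auto simp: pmf_eq_0_set_pmf\<close>)
    also have "\<dots> = m (pmf Q) E"
      unfolding m_def using C by (subst measure_measure_pmf_finite) auto
    finally show ?thesis by simp
  qed
  have in_V: "pmf Q \<in> V" if Q: "Q \<in> kwise_dists n k p" for Q
  proof -
    have s: "set_pmf Q \<subseteq> C" using Q by (simp add: kwise_dists_def C_def)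
    then have "pmf Q x = 0" if "x \<notin> C" for x using that by (auto simp: pmf_eq_0_set_pmf)
    with s Q show ?thesis
      unfolding V_def kwise_dists_def
      by (auto simp: m_eq kwise_independent_iff pmf_le_1)
  qed
  have from_V: "\<exists>Q\<in>kwise_dists n k p. pmf Q = v" if v: "v \<in> V" for v
  proof -
    have nn: "v x \<ge> 0" for x
      using v by (auto simp: V_def PiE_iff split: if_splits dest!: spec[of _ x])
    have z: "v x = 0" if "x \<notin> C" for x
      using v that by (auto simp: V_def PiE_iff split: if_splits dest!: spec[of _ x])
    have "(\<integral>\<^sup>+x. ennreal (v x) \<partial>count_space UNIV) = (\<Sum>x\<in>C. ennreal (v x))"
      by (intro nn_integral_count_space'[OF C]) (auto simp: z)
    also have "\<dots> = ennreal (\<Sum>x\<in>C. v x)" using nn by simp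
    also have "\<dots> = 1" using v by (simp add: V_def m_def)
    finally have int: "(\<integral>\<^sup>+x. ennreal (v x) \<partial>count_space UNIV) = 1" .
    have Q: "pmf (embed_pmf v) = v"
      using pmf_embed_pmf[OF nn int] by auto
    have s: "set_pmf (embed_pmf v) \<subseteq> C"
      using Q z by (force simp: set_pmf_iff)
    have "embed_pmf v \<in> kwise_dists n k p"
      using v s m_eq[OF s] unfolding V_def kwise_dists_def
      by (auto simp: kwise_independent_iff Q C_def)
    then show ?thesis using Q by blast
  qed
  have "V \<noteq> {}" using in_V indep_bits_in_kwise_dists[OF p] by blast
  then obtain v where v: "v \<in> V" "\<And>w. w \<in> V \<Longrightarrow> m w F \<le> m v F"
    using continuous_attains_sup[OF \<open>compact V\<close> _ continuous_on_subset[OF cont]] by blast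
  obtain Q where Q: "Q \<in> kwise_dists n k p" "pmf Q = v" using from_V v by blast
  have sub: "set_pmf Q' \<subseteq> C" if "Q' \<in> kwise_dists n k p" for Q'
    using that by (simp add: kwise_dists_def C_def)
  show ?thesis
    using Q v(2) in_V m_eq sub by (metis)
qed

lemma kwise_dists_attains_max:
  assumes "p \<in> {0..1}"
  shows "\<exists>Q\<in>kwise_dists n k p.
           measure_pmf.prob Q {x. f x} = (SUP Q\<in>kwise_dists n k p. measure_pmf.prob Q {x. f x})"
proof -
  obtain Q where "Q \<in> kwise_dists n k p"
    "\<forall>Q'\<in>kwise_dists n k p. measure_pmf.prob Q' {x. f x} \<le> measure_pmf.prob Q {x. f x}"
    using kwise_dists_attains[OF assms, of n k "{x. f x}"] by blast
  then show ?thesis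
    by (intro bexI[of _ Q] cSup_eq_maximum[symmetric]) auto
qed

lemma kwise_dists_attains_min:
  assumes "p \<in> {0..1}"
  shows "\<exists>Q\<in>kwise_dists n k p.
           measure_pmf.prob Q {x. f x} = (INF Q\<in>kwise_dists n k p. measure_pmf.prob Q {x. f x})"
proof -
  have compl: "measure_pmf.prob Q (- {x. f x}) = 1 - measure_pmf.prob Q {x. f x}" for Q
    using measure_pmf.prob_compl[of "{x. f x}" Q] by (simp add: Compl_eq_Diff_UNIV)
  obtain Q where "Q \<in> kwise_dists n k p"
    "\<forall>Q'\<in>kwise_dists n k p. measure_pmf.prob Q {x. f x} \<le> measure_pmf.prob Q' {x. f x}"
    using kwise_dists_attains[OF assms, of n k "- {x. f x}"] by (auto simp: compl)
  then show ?thesis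
    by (intro bexI[of _ Q] cInf_eq_minimum[symmetric]) auto
qed

end

theory Submission
  imports Defs
begin

text \<open>
  For pairwise independent bits the number of ones has variance \<open>n p (1 - p)\<close>, just as for
  independent bits, so for \<open>p \<noteq> 1/2\<close> Chebyshev's inequality fixes the majority with an error
  \<open>O(1/n)\<close> that is uniform over the class. With \<open>k = 1\<close> all bits may be equal; the majority is
  then \<open>1\<close> with probability \<open>p\<close>, whereas for \<open>p < 1/2\<close> it tends to \<open>0\<close> under independent bits.
\<close>

section \<open>Second moments under pairwise independence\<close>

lemma integrable_kwise_dists:
  fixes g :: "(nat \<Rightarrow> bool) \<Rightarrow> real"
  assumes "Q \<in> kwise_dists n k p"
  shows "integrable (measure_pmf Q) g"
  using assms finite_subset[OF _ finite_cube]
  by (intro integrable_measure_pmf_finite) (auto simp: kwise_dists_def)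

text \<open>Covariances see only two bits at a time, so the case \<open>k = 2\<close> of
  independence already makes them agree with those of independent bits.\<close>

lemma expectation_centred_bits:
  assumes Q: "Q \<in> kwise_dists n 2 p" and i: "i < n" and j: "j < n"
  shows "measure_pmf.expectation Q (\<lambda>x. (of_bool (x i) - p) * (of_bool (x j) - p)) =
           (if i = j then p * (1 - p) else 0)"
proof -
  have marg: "measure_pmf.prob Q {x. x l} = p" if "l < n" for l
    using Q that by (simp add: kwise_dists_def)
  have pair: "measure_pmf.prob Q {x. x i \<and> x j} = (if i = j then p else p * p)"
  proof (cases "i = j")
    case False
    \<comment> \<open>The product formula for \<open>S = J = {i,j}\<close>, a set of size exactly 2,
      with every \<open>B l\<close> equal to \<open>{True}\<close>.\<close>
    have "measure_pmf.prob Q {x. \<forall>l\<in>{i,j}. x l \<in> {True}} =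
            (\<Prod>l\<in>{i,j}. measure_pmf.prob Q {x. x l \<in> {True}})"
      using i j False
      by (intro Q[unfolded kwise_dists_def kwise_independent_iff mem_Collect_eq,
            THEN conjunct2, THEN conjunct1, rule_format, of "{i,j}"]) auto
    then show ?thesis
      using False i j by (simp add: marg)
  qed (simp add: marg j)
  have "measure_pmf.expectation Q (\<lambda>x. (of_bool (x i) - p) * (of_bool (x j) - p)) =
        measure_pmf.expectation Q (\<lambda>x. indicator {x. x i \<and> x j} x - p * indicator {x. x i} x
           - p * indicator {x. x j} x + p * p)"
    by (intro Bochner_Integration.integral_cong) (auto simp: indicator_def algebra_simps)
  also have "\<dots> = measure_pmf.prob Q {x. x i \<and> x j} - p * measure_pmf.prob Q {x. x i}
           - p * measure_pmf.prob Q {x. x j} + p * p"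
    by (simp add: measure_pmf.emeasure_eq_measure)
  also have "\<dots> = (if i = j then p * (1 - p) else 0)"
    by (simp add: pair marg i j algebra_simps)
  finally show ?thesis .
qed

text \<open>The square of the sum of centred bits expands into a double sum, of which only the
  \<open>n\<close> diagonal terms survive in expectation.\<close>

lemma expectation_count_deviation:
  assumes Q: "Q \<in> kwise_dists n 2 p"
  shows "measure_pmf.expectation Q (\<lambda>x. (real (card {i. i < n \<and> x i}) - n * p)\<^sup>2) =
           n * (p * (1 - p))"
proof -
  have int: "integrable (measure_pmf Q) (\<lambda>x. (of_bool (x i) - p) * (of_bool (x j) - p))" for i j
    by (rule integrable_kwise_dists[OF Q])
  have "card {i. i < n \<and> x i} = (\<Sum>i<n. of_bool (x i))" for x
    by (simp add: Int_def sum_of_bool_eq conj_commute)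
  then have "(real (card {i. i < n \<and> x i}) - n * p)\<^sup>2 =
          (\<Sum>i<n. \<Sum>j<n. (of_bool (x i) - p) * (of_bool (x j) - p))" for x
    by (simp add: power2_eq_square sum_product [symmetric] sum_subtractf)
  then have "measure_pmf.expectation Q (\<lambda>x. (real (card {i. i < n \<and> x i}) - n * p)\<^sup>2) =
          (\<Sum>i<n. \<Sum>j<n. if i = j then p * (1 - p) else 0)"
    by (simp add: int expectation_centred_bits[OF Q])
  then show ?thesis
    by simp
qed

section \<open>Chebyshev's inequality for majority\<close>

lemma Maj_iff: "Maj n x \<longleftrightarrow> real n < 2 * real (card {i. i < n \<and> x i})"
proof -
  have "{i. i < n \<and> \<not> x i} = {..<n} - {i. i < n \<and> x i}"
    by auto
  then have "card {i. i < n \<and> \<not> x i} = n - card {i. i < n \<and> x i}"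
    by (simp add: card_Diff_subset subset_eq)
  then show ?thesis
    unfolding Maj_def by linarith
qed

lemma Maj_prob_bound:
  assumes Q: "Q \<in> kwise_dists n 2 p" and n: "n > 0" and p: "p \<in> {0..1}" "p \<noteq> 1/2"
  shows "\<bar>measure_pmf.prob Q {x. Maj n x} - of_bool (p > 1/2)\<bar> \<le> 1 / (1 - 2 * p)\<^sup>2 / n"
proof -
  define S where "S x = real (card {i. i < n \<and> x i})" for x
  \<comment> \<open>The distance from the mean \<open>n * p\<close> to the decision boundary
    \<open>n / 2\<close>; a wrong majority forces a deviation at least this large.\<close>
  define a where "a = n * \<bar>1/2 - p\<bar>"
  have a: "a > 0"
    using n p by (simp add: a_def)
  have int: "integrable (measure_pmf Q) (\<lambda>x. (S x - n * p)\<^sup>2)"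
    by (rule integrable_kwise_dists[OF Q])
  \<comment> \<open>Chebyshev, as Markov's inequality for the squared deviation.\<close>
  have "measure_pmf.prob Q {x. a\<^sup>2 \<le> (S x - n * p)\<^sup>2} \<le>
          measure_pmf.expectation Q (\<lambda>x. (S x - n * p)\<^sup>2) / a\<^sup>2"
    using integral_Markov_inequality_measure[OF int, of UNIV "a\<^sup>2"] a by simp
  also have "\<dots> = n * (p * (1 - p)) / a\<^sup>2"
    unfolding S_def by (simp add: expectation_count_deviation[OF Q])
  \<comment> \<open>Here \<open>p * (1 - p) \<le> 1/4\<close>, because the difference is the square
    of \<open>p - 1/2\<close>.\<close>
  also have "\<dots> \<le> n * (1 / 4) / a\<^sup>2"
    using sum_squares_bound[of p "1 - p"] zero_le_power2[of "p - 1/2"]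
    by (intro divide_right_mono mult_left_mono) (auto simp: power2_eq_square algebra_simps)
  also have "\<dots> = 1 / (1 - 2 * p)\<^sup>2 / n"
  proof -
    have "a\<^sup>2 = (real n)\<^sup>2 * ((1 - 2 * p)\<^sup>2 / 4)"
      by (simp add: a_def power_mult_distrib power2_eq_square algebra_simps)
    then show ?thesis
      using n by (simp only:) (simp add: power2_eq_square)
  qed
  finally have dev: "measure_pmf.prob Q {x. a\<^sup>2 \<le> (S x - n * p)\<^sup>2} \<le> 1 / (1 - 2 * p)\<^sup>2 / n" .
  \<comment> \<open>The inequality is not strict because of ties: for \<open>p > 1/2\<close> and
    even \<open>n\<close>, a count of exactly \<open>n / 2\<close> is already wrong.\<close>
  have wrong: "a\<^sup>2 \<le> (S x - n * p)\<^sup>2" if "Maj n x \<noteq> (p > 1/2)" for x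
  proof -
    have "a \<le> \<bar>S x - n * p\<bar>"
    proof (cases "p > 1/2")
      case True
      then have "a = n * p - n / 2" by (simp add: a_def algebra_simps)
      then show ?thesis using that True by (simp add: Maj_iff S_def)
    next
      case False
      then have "a = n / 2 - n * p" by (simp add: a_def algebra_simps)
      then show ?thesis using that False by (simp add: Maj_iff S_def)
    qed
    then show ?thesis
      using a by (simp add: abs_le_square_iff[symmetric])
  qed
  \<comment> \<open>The target is 0 or 1, so the distance to it is the probability of the wrong
    output.\<close>
  have "\<bar>measure_pmf.prob Q {x. Maj n x} - of_bool (p > 1/2)\<bar> =
          measure_pmf.prob Q {x. Maj n x \<noteq> (p > 1/2)}"
    using measure_pmf.prob_compl[of "{x. Maj n x}" Q]
    by (auto simp: Collect_neg_eq Compl_eq_Diff_UNIV)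
  also have "\<dots> \<le> measure_pmf.prob Q {x. a\<^sup>2 \<le> (S x - n * p)\<^sup>2}"
    using wrong by (intro measure_pmf.finite_measure_mono) auto
  finally show ?thesis
    using dev by simp
qed

section \<open>Sharp threshold of majority\<close>

lemma tendsto_at_top_within_inverse_bound:
  fixes g :: "nat \<Rightarrow> real"
  assumes "\<And>n. n > 0 \<Longrightarrow> \<bar>g n - l\<bar> \<le> C / n"
  shows "(g \<longlongrightarrow> l) (at_top_within N)"
proof -
  have "(\<lambda>n. C / real n) \<longlonglongrightarrow> 0"
    by (rule lim_const_over_n)
  then have "(\<lambda>n. g n - l) \<longlonglongrightarrow> 0"
    by (rule Lim_null_comparison[rotated])
       (auto intro!: eventually_mono[OF eventually_gt_at_top[of 0]] assms)
  then have "g \<longlonglongrightarrow> l"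
    by (simp add: LIM_zero_iff)
  then show ?thesis
    unfolding at_top_within_def by (rule tendsto_mono[rotated]) simp
qed

text \<open>Independent bits belong to the class with \<open>k = 2\<close>, so the uniform bound
  replaces a separate law of large numbers.\<close>

lemma Maj_indep_bits_tendsto:
  assumes "p \<in> {0..1}" "p \<noteq> 1/2"
  shows "((\<lambda>n. measure_pmf.prob (indep_bits n p) {x. Maj n x}) \<longlongrightarrow> of_bool (p > 1/2))
           (at_top_within N)"
  by (rule tendsto_at_top_within_inverse_bound)
     (rule Maj_prob_bound[OF indep_bits_in_kwise_dists[OF assms(1)] _ assms])

lemma mono_Maj: "mono (Maj n)"
proof (rule monoI)
  fix x y :: "nat \<Rightarrow> bool" assume "x \<le> y"
  then have "card {i. i < n \<and> x i} \<le> card {i. i < n \<and> y i}"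
    by (intro card_mono) (auto simp: le_fun_def)
  then show "Maj n x \<le> Maj n y"
    by (auto simp: Maj_iff)
qed

text \<open>Since \<open>critical_prob\<close> is a definite description, uniqueness of the
  threshold is needed as well; this is where \<open>N\<close> must be infinite.\<close>

lemma critical_prob_Maj:
  assumes "infinite N"
  shows "critical_prob N Maj = 1/2"
proof -
  have half: "has_sharp_threshold N Maj (1/2)"
    unfolding has_sharp_threshold_def
  proof (intro conjI ballI impI)
    show "mono_on (cube n) (Maj n)" for n
      using mono_Maj subset_UNIV by (rule mono_on_subset)
  next
    fix p :: real assume "p \<in> {0..1}" "p < 1/2"
    then show "((\<lambda>n. measure_pmf.prob (indep_bits n p) {x. Maj n x}) \<longlongrightarrow> 0) (at_top_within N)"
      using Maj_indep_bits_tendsto[of p N] by simp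
  next
    fix p :: real assume "p \<in> {0..1}" "p > 1/2"
    then show "((\<lambda>n. measure_pmf.prob (indep_bits n p) {x. Maj n x}) \<longlongrightarrow> 1) (at_top_within N)"
      using Maj_indep_bits_tendsto[of p N] by simp
  qed simp
  then show ?thesis
    unfolding critical_prob_def
    by (rule the_equality) (rule has_sharp_threshold_unique[OF assms _ half])
qed

section \<open>Bounds on \<open>eps\<close> for \<open>k = 2\<close> and
  \<open>k = 1\<close>\<close>

lemma eps_ge_diff:
  assumes "Q \<in> kwise_dists n k p" "Q' \<in> kwise_dists n k p"
  shows "measure_pmf.prob Q {x. f x} - measure_pmf.prob Q' {x. f x} \<le> eps n f k p"
proof -
  have "measure_pmf.prob Q {x. f x} \<le> (SUP Q\<in>kwise_dists n k p. measure_pmf.prob Q {x. f x})"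
    using assms by (intro cSUP_upper bdd_aboveI2[where M = 1]) auto
  moreover have "(INF Q\<in>kwise_dists n k p. measure_pmf.prob Q {x. f x}) \<le> measure_pmf.prob Q' {x. f x}"
    using assms by (intro cINF_lower bdd_belowI2[where m = 0]) auto
  ultimately show ?thesis
    unfolding eps_def by linarith
qed

text \<open>As both extrema are attained, \<open>eps\<close> is a difference of two probabilities
  close to the same limit, which doubles the constant.\<close>

lemma eps_Maj_bound:
  assumes n: "n > 0" and p: "p \<in> {0..1}" "p \<noteq> 1/2"
  shows "\<bar>eps n (Maj n) 2 p\<bar> \<le> 2 / (1 - 2 * p)\<^sup>2 / n"
proof -
  obtain Q Q' where Q: "Q \<in> kwise_dists n 2 p" "Q' \<in> kwise_dists n 2 p"
    and eps: "eps n (Maj n) 2 p =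
      measure_pmf.prob Q {x. Maj n x} - measure_pmf.prob Q' {x. Maj n x}"
    using kwise_dists_attains_max[OF p(1), of n 2 "Maj n"]
      kwise_dists_attains_min[OF p(1), of n 2 "Maj n"]
    unfolding eps_def by (metis (no_types, lifting))
  show ?thesis
    using Maj_prob_bound[OF Q(1) n p] Maj_prob_bound[OF Q(2) n p] unfolding eps by linarith
qed

text \<open>One Bernoulli bit copied to all \<open>n\<close> positions; the conjunct
  \<open>i < n\<close> keeps the default value \<open>False\<close> outside, as
  \<open>cube n\<close> demands.\<close>

definition equal_bits :: "nat \<Rightarrow> real \<Rightarrow> (nat \<Rightarrow> bool) pmf" where
  "equal_bits n p = map_pmf (\<lambda>b i. i < n \<and> b) (bernoulli_pmf p)"

lemma equal_bits_in_kwise_dists: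
  assumes "p \<in> {0..1}"
  shows "equal_bits n p \<in> kwise_dists n 1 p"
proof -
  have "set_pmf (equal_bits n p) \<subseteq> cube n"
    by (auto simp: equal_bits_def cube_def PiE_dflt_def)
  moreover have "kwise_independent n 1 (equal_bits n p)"
    unfolding kwise_independent_iff
  proof (intro allI impI)
    fix S J and B :: "nat \<Rightarrow> bool set"
    assume "S \<subseteq> {..<n}" "card S \<le> 1" "J \<subseteq> S" "J \<noteq> {}" "finite J"
    \<comment> \<open>A nonempty \<open>J\<close> inside a set of size at most 1 is a singleton, for
      which the product formula is trivial.\<close>
    then have "card J = 1"
      by (metis One_nat_def Suc_leI card_gt_0_iff card_mono finite_lessThan finite_subset le_antisym le_trans)
    then obtain j where "J = {j}"
      by (rule card_1_singletonE)
    then show "measure_pmf.prob (equal_bits n p) {x. \<forall>j\<in>J. x j \<in> B j} =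
        (\<Prod>j\<in>J. measure_pmf.prob (equal_bits n p) {x. x j \<in> B j})"
      by simp
  qed
  moreover have "measure_pmf.prob (equal_bits n p) {x. x i} = p" if "i < n" for i
  proof -
    have "(\<lambda>b i. i < n \<and> b) -` {x. x i} = {True}"
      using that by auto
    then show ?thesis
      using assms by (simp add: equal_bits_def measure_pmf_single)
  qed
  ultimately show ?thesis
    by (simp add: kwise_dists_def)
qed

lemma Maj_equal_bits:
  assumes "p \<in> {0..1}" "n > 0"
  shows "measure_pmf.prob (equal_bits n p) {x. Maj n x} = p"
proof -
  have "Maj n (\<lambda>i. i < n \<and> b) \<longleftrightarrow> b" for b
    using assms by (cases b) (simp_all add: Maj_iff)
  then have "(\<lambda>b i. i < n \<and> b) -` {x. Maj n x} = {True}"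
    by auto
  then show ?thesis
    using assms by (simp add: equal_bits_def measure_pmf_single)
qed

lemma const_2_in_K1_Maj:
  assumes "infinite N"
  shows "(\<lambda>_. 2) \<in> K1 N Maj"
  unfolding K1_def critical_prob_Maj[OF assms] mem_Collect_eq
proof (intro ballI impI)
  fix p :: real assume p: "p \<in> {0..1}" "p \<noteq> 1/2"
  show "((\<lambda>n. eps n (Maj n) 2 p) \<longlongrightarrow> 0) (at_top_within N)"
    by (rule tendsto_at_top_within_inverse_bound[where C = "2 / (1 - 2 * p)\<^sup>2"])
       (simp only: diff_0_right eps_Maj_bound[OF _ p])
qed

lemma const_1_notin_K1_Maj:
  assumes N: "infinite N"
  shows "(\<lambda>_. 1) \<notin> K1 N Maj"
proof
  \<comment> \<open>Any \<open>p\<close> strictly between 0 and \<open>1/2\<close> would serve: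
    equal bits give majority probability \<open>p\<close>, independent bits give a limit of
    0.\<close>
  let ?F = "at_top_within N" and ?p = "1/4 :: real"
  let ?P = "\<lambda>n. measure_pmf.prob (indep_bits n ?p) {x. Maj n x}"
  assume "(\<lambda>_. 1) \<in> K1 N Maj"
  then have "((\<lambda>n. eps n (Maj n) 1 ?p) \<longlongrightarrow> 0) ?F"
    by (auto simp: K1_def critical_prob_Maj[OF N])
  moreover have "(?P \<longlongrightarrow> 0) ?F"
    using Maj_indep_bits_tendsto[of ?p N] by simp
  ultimately have lim: "((\<lambda>n. eps n (Maj n) 1 ?p + ?P n) \<longlongrightarrow> 0) ?F"
    using tendsto_add by fastforce
  \<comment> \<open>\<open>eps\<close> is at least the gap between equal and independent bits;
    moving \<open>?P n\<close> to the right leaves a constant lower bound for a null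
    sequence.\<close>
  have "?p \<le> eps n (Maj n) 1 ?p + ?P n" if "n > 0" for n
    using eps_ge_diff[OF equal_bits_in_kwise_dists indep_bits_in_kwise_dists, of ?p n "Maj n"] that
    by (simp add: Maj_equal_bits)
  then have "\<forall>\<^sub>F n in ?F. ?p \<le> eps n (Maj n) 1 ?p + ?P n"
    unfolding at_top_within_def
    by (intro filter_leD[OF inf_le1] eventually_mono[OF eventually_gt_at_top[of 0]])
  \<comment> \<open>Along the trivial filter every limit holds, so the contradiction needs
    \<open>N\<close> infinite.\<close>
  moreover have "?F \<noteq> bot"
    using N by (auto simp: at_top_within_def trivial_limit_def eventually_inf_principal
        eventually_sequentially infinite_nat_iff_unbounded_le)
  ultimately have "?p \<le> 0"
    by (intro tendsto_lowerbound[OF lim])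
  then show False
    by simp
qed

theorem theorem8:
  shows "(\<lambda>_. 2) \<in> K1 {n. odd n} Maj \<and> (\<lambda>_. 1) \<notin> K1 {n. odd n} Maj"
proof -
  have "infinite {n :: nat. odd n}"
    unfolding infinite_nat_iff_unbounded_le
  proof
    fix m :: nat
    show "\<exists>n\<ge>m. n \<in> {n. odd n}"
      by (rule exI[of _ "Suc (2 * m)"]) simp
  qed
  then show ?thesis
    using const_2_in_K1_Maj const_1_notin_K1_Maj by blast
qed

end
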